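(* Let $m\ge 0$ be an integer and let $\{X_n;n\geq 1\}$ be a sequence of $m$-dependent random variables in a sublinear expectation space $(\Omega,\mathcal{H},\widehat{\mathbb{E}})$ with $\widehat{\mathbb{E}}[X_n]=\widehat{\mathcal{E}}[X_n]=0$ for all $n\geq 1$. Set $S_n=\sum_{i=1}^n X_i$, and suppose $\{a_n\}_{n\geq 1}$ is a real sequence such that $1\leq a_n\nearrow\infty$ and $$\sum_{n=1}^{\infty}\frac{\widehat{\mathbb{E}}[X_n^2]}{a_n^2}<\infty.$$ Then $$\hat{\mathbb{V}}^*\left(\limsup_{n\rightarrow\infty}\frac{S_n}{a_n}>0\ \text{ or }\ \liminf_{n\rightarrow\infty}\frac{S_n}{a_n}<0\right)=0.$$
   Context: Setting. $(\Omega,\mathcal{F})$ is a measurable space and $\mathcal{H}$ is a linear space of real-valued ($\mathcal{F}$-measurable) functions on $\Omega$ such that $X_1,\dots,X_n\in\mathcal{H}$ implies $\varphi(X_1,\dots,X_n)\in\mathcal{H}$ for every $\varphi\in C_{l,Lip}(\mathbb{R}^n)$. Here $C_{l,Lip}(\mathbb{R}^n)$ is the space of functions $\varphi$ with $|\varphi(x)-\varphi(y)|\le C(1+|x|^q+|y|^q)|x-y|$ for all $x,y\in\mathbb{R}^n$, for some $C>0$, $q\in\mathbb{N}$ depending on $\varphi$. $C_{b,Lip}(\mathbb{R}^n)$ is the space of bounded Lipschitz functions. Elements of $\mathcal{H}$ are called random variables. A sublinear expectation is a functional $\widehat{\mathbb{E}}:\mathcal{H}\to\mathbb{R}$ satisfying: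 (i) $\widehat{\mathbb{E}}[X]\le\widehat{\mathbb{E}}[Y]$ if $X\le Y$; (ii) $\widehat{\mathbb{E}}[c]=c$ for $c\in\mathbb{R}$; (iii) $\widehat{\mathbb{E}}[X+Y]\le\widehat{\mathbb{E}}[X]+\widehat{\mathbb{E}}[Y]$; (iv) $\widehat{\mathbb{E}}[\lambda X]=\lambda\widehat{\mathbb{E}}[X]$ for $\lambda\ge 0$. The triple $(\Omega,\mathcal{H},\widehat{\mathbb{E}})$ is a sublinear expectation space, and $\widehat{\mathcal{E}}[X]:=-\widehat{\mathbb{E}}[-X]$. Independence. A random vector $\boldsymbol{Y}\in\mathcal{H}^n$ is independent of a random vector $\boldsymbol{X}\in\mathcal{H}^k$ if $\widehat{\mathbb{E}}[\varphi(\boldsymbol{X},\boldsymbol{Y})]=\widehat{\mathbb{E}}\big[\widehat{\mathbb{E}}[\varphi(\boldsymbol{x},\boldsymbol{Y})]|_{\boldsymbol{x}=\boldsymbol{X}}\big]$ for every $\varphi\in C_{b,Lip}(\mathbb{R}^{k+n})$ (this relation is not symmetric in general). $m$-dependence. $\{X_n;n\ge1\}$ is $m$-dependent if $(X_{n+m+1},\dots,X_{n+j})$ is independent of $(X_1,\dots,X_n)$ for every $n\ge 1$ and every $j\ge m+1$. Capacities. For $A\in\mathcal{F}$, $\hat{\mathbb{V}}(A):=\inf\{\widehat{\mathbb{E}}[\xi]: I_A\le\xi,\ \xi\in\mathcal{H}\}$ and $\hat{\mathbb{V}}^*(A):=\inf\{\sum_{n=1}^\infty\hat{\mathbb{V}}(A_n):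 A\subset\bigcup_{n=1}^\infty A_n,\ A_n\in\mathcal{F}\}$. *)

theory Defs
  imports "HOL-Analysis.Analysis"
begin

text \<open>
  Vectors in \<open>\<real>\<^sup>n\<close> are real lists of length \<open>n\<close>, since the dimension varies within
  a single statement. Accordingly, functions on \<open>\<real>\<^sup>n\<close> are functions on lists of which
  only the values at lists of length \<open>n\<close> matter, and concatenation of vectors is \<open>@\<close>.
\<close>

definition norm_list :: "real list \<Rightarrow> real" where
  "norm_list x = L2_set (\<lambda>i. x ! i) {..<length x}"

definition dist_list :: "real list \<Rightarrow> real list \<Rightarrow> real" where
  "dist_list x y = norm_list (map2 (-) x y)"

definition C_l_Lip :: "nat \<Rightarrow> (real list \<Rightarrow> real) set" where
  "C_l_Lip n = {\<phi>. \<exists>C>0. \<exists>q::nat. \<forall>x y. length x = n \<longrightarrow> length y = n \<longrightarrow>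
     \<bar>\<phi> x - \<phi> y\<bar> \<le> C * (1 + norm_list x ^ q + norm_list y ^ q) * dist_list x y}"

definition C_b_Lip :: "nat \<Rightarrow> (real list \<Rightarrow> real) set" where
  "C_b_Lip n = {\<phi>.
     (\<exists>B. \<forall>x. length x = n \<longrightarrow> \<bar>\<phi> x\<bar> \<le> B) \<and>
     (\<exists>L. \<forall>x y. length x = n \<longrightarrow> length y = n \<longrightarrow> \<bar>\<phi> x - \<phi> y\<bar> \<le> L * dist_list x y)}"

definition rvec :: "('w \<Rightarrow> real) list \<Rightarrow> 'w \<Rightarrow> real list" where
  "rvec Xs \<omega> = map (\<lambda>X. X \<omega>) Xs"

text \<open>
  The measurable space \<open>(\<Omega>, \<F>)\<close> is \<open>(space M, sets M)\<close>; the measure carried by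
  \<open>M\<close> is irrelevant. The functional \<open>E\<close> is only constrained on \<open>H\<close>. Random
  variables are compared on \<open>space M\<close> only, so by \<open>mono\<close> their values elsewhere
  do not affect \<open>E\<close>.
\<close>

locale sublinear_expectation_space =
  fixes M :: "'w measure"
    and H :: "('w \<Rightarrow> real) set"
    and E :: "('w \<Rightarrow> real) \<Rightarrow> real"
  assumes H_measurable: "H \<subseteq> borel_measurable M"
    and H_zero: "(\<lambda>\<omega>. 0) \<in> H"
    and H_add: "\<And>X Y. X \<in> H \<Longrightarrow> Y \<in> H \<Longrightarrow> (\<lambda>\<omega>. X \<omega> + Y \<omega>) \<in> H"
    and H_scale: "\<And>c X. X \<in> H \<Longrightarrow> (\<lambda>\<omega>. c * X \<omega>) \<in> H"
    and H_comp: "\<And>Xs \<phi>. set Xs \<subseteq> H \<Longrightarrow> \<phi> \<in> C_l_Lip (length Xs) \<Longrightarrow> (\<lambda>\<omega>. \<phi> (rvec Xs \<omega>)) \<in> H"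
    and mono: "\<And>X Y. X \<in> H \<Longrightarrow> Y \<in> H \<Longrightarrow> (\<And>\<omega>. \<omega> \<in> space M \<Longrightarrow> X \<omega> \<le> Y \<omega>) \<Longrightarrow> E X \<le> E Y"
    and const: "\<And>c. E (\<lambda>\<omega>. c) = c"
    and subadd: "\<And>X Y. X \<in> H \<Longrightarrow> Y \<in> H \<Longrightarrow> E (\<lambda>\<omega>. X \<omega> + Y \<omega>) \<le> E X + E Y"
    and pos_homogeneous: "\<And>c X. X \<in> H \<Longrightarrow> 0 \<le> c \<Longrightarrow> E (\<lambda>\<omega>. c * X \<omega>) = c * E X"

definition conj_expectation :: "(('w \<Rightarrow> real) \<Rightarrow> real) \<Rightarrow> ('w \<Rightarrow> real) \<Rightarrow> real" where
  "conj_expectation E X = - E (\<lambda>\<omega>. - X \<omega>)"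

text \<open>
  \<open>indep_of E Ys Xs\<close>: the vector \<open>Ys\<close> is independent of the vector \<open>Xs\<close>
  (not symmetric). Intended for vectors with components in \<open>H\<close>.
\<close>

definition indep_of ::
  "(('w \<Rightarrow> real) \<Rightarrow> real) \<Rightarrow> ('w \<Rightarrow> real) list \<Rightarrow> ('w \<Rightarrow> real) list \<Rightarrow> bool" where
  "indep_of E Ys Xs \<longleftrightarrow> (\<forall>\<phi> \<in> C_b_Lip (length Xs + length Ys).
     E (\<lambda>\<omega>. \<phi> (rvec Xs \<omega> @ rvec Ys \<omega>))
     = E (\<lambda>\<omega>. (\<lambda>x. E (\<lambda>\<omega>'. \<phi> (x @ rvec Ys \<omega>'))) (rvec Xs \<omega>)))"

text \<open>Sequences are indexed from 1; \<open>X 0\<close> is not used.\<close>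

definition m_dependent ::
  "(('w \<Rightarrow> real) \<Rightarrow> real) \<Rightarrow> nat \<Rightarrow> (nat \<Rightarrow> 'w \<Rightarrow> real) \<Rightarrow> bool" where
  "m_dependent E m X \<longleftrightarrow> (\<forall>n\<ge>1. \<forall>j\<ge>m + 1.
     indep_of E (map X [n + m + 1..<n + j + 1]) (map X [1..<n + 1]))"

definition capacity ::
  "'w measure \<Rightarrow> ('w \<Rightarrow> real) set \<Rightarrow> (('w \<Rightarrow> real) \<Rightarrow> real) \<Rightarrow> 'w set \<Rightarrow> real" where
  "capacity M H E A = Inf {E \<xi> |\<xi>. \<xi> \<in> H \<and> (\<forall>\<omega>\<in>space M. indicator A \<omega> \<le> \<xi> \<omega>)}"

text \<open>
  The series may diverge, hence the values in \<^typ>\<open>ennreal\<close>; \<^const>\<open>capacity\<close> takes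
  values in \<open>[0, 1]\<close> on a sublinear expectation space, so \<^const>\<open>ennreal\<close> does not
  truncate.
\<close>

definition outer_capacity ::
  "'w measure \<Rightarrow> ('w \<Rightarrow> real) set \<Rightarrow> (('w \<Rightarrow> real) \<Rightarrow> real) \<Rightarrow> 'w set \<Rightarrow> ennreal" where
  "outer_capacity M H E A =
     Inf {(\<Sum>n. ennreal (capacity M H E (B n))) |B::nat \<Rightarrow> 'w set.
            (\<forall>n. B n \<in> sets M) \<and> A \<subseteq> (\<Union>n. B n)}"

end

theory Submission
  imports Defs
begin

text \<open>
  A Kolmogorov type maximal inequality replaces the stopping times of the classical proof, which
  have no counterpart in \<open>H\<close>, by the pathwise Doob inequality
  \<open>M\<^sub>n\<^sup>2 \<le> 4 \<Sum> Y\<^sub>k\<^sup>2 + \<Sum> (8 s\<^sub>k - 4 M\<^sub>k) Y\<^sub>k\<close>, in which every term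
  \<open>(8 s\<^sub>k - 4 M\<^sub>k) Y\<^sub>k\<close> has upper expectation at most 0. It is applied to the subsequences of
  \<open>X\<close> along the residue classes modulo \<open>m + 1\<close>. As the capacity need not be
  countably subadditive, only finite maxima may be estimated: one takes the blocks \<open>a\<^sub>n < 2\<^sup>k\<^sup>+\<^sup>1\<close>, for which
  the bounds \<open>4\<^sup>-\<^sup>k \<Sum> E X\<^sub>i\<^sup>2\<close> are summable in \<open>k\<close>, and covers the exceptional set by the
  block events.
\<close>

section \<open>Euclidean distance on lists and truncation\<close>

lemma norm_list_nth_le: "i < length x \<Longrightarrow> \<bar>x ! i\<bar> \<le> norm_list x"
  unfolding norm_list_def L2_set_def
  by (rule real_le_rsqrt) (auto intro!: member_le_sum[where f = "\<lambda>i. (x ! i)\<^sup>2"])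

lemma norm_list_nonneg [simp]: "0 \<le> norm_list x"
  by (simp add: norm_list_def)

lemma dist_list_nonneg [simp]: "0 \<le> dist_list x y"
  by (simp add: dist_list_def)

lemma dist_list_nth_le:
  assumes "length x = n" "length y = n" "i < n"
  shows "\<bar>x ! i - y ! i\<bar> \<le> dist_list x y"
  using norm_list_nth_le[of i "map2 (-) x y"] assms by (simp add: dist_list_def)

lemma sum_nth_le_dist_list:
  assumes "length x = n" "length y = n" "k \<le> n"
  shows "(\<Sum>i<k. \<bar>x ! i - y ! i\<bar>) \<le> k * dist_list x y"
  using sum_bounded_above[of "{..<k}" "\<lambda>i. \<bar>x ! i - y ! i\<bar>" "dist_list x y"]
    dist_list_nth_le[OF assms(1,2)] assms(3) by simp

definition clip :: "real \<Rightarrow> real \<Rightarrow> real" where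
  "clip b x = max (- b) (min b x)"

lemma abs_clip_le: "0 \<le> b \<Longrightarrow> \<bar>clip b x\<bar> \<le> b"
  by (auto simp: clip_def)

lemma clip_lipschitz: "\<bar>clip b x - clip b y\<bar> \<le> \<bar>x - y\<bar>"
  by (auto simp: clip_def max_def min_def)

text \<open>The error is 0 up to level \<open>b\<close>; above it, \<open>\<bar>x\<bar>\<close>
  itself is at most \<open>x\<^sup>2 / b\<close>. A quadratic bound is chosen so that second moments
  pay for truncation.\<close>

lemma clip_error:
  assumes "0 < b"
  shows "\<bar>x - clip b x\<bar> \<le> x\<^sup>2 / b"
proof (cases "\<bar>x\<bar> \<le> b")
  case True
  then show ?thesis using assms by (auto simp: clip_def)
next
  case False
  then have "\<bar>x - clip b x\<bar> \<le> \<bar>x\<bar>"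
    using assms by (auto simp: clip_def)
  also have "\<bar>x\<bar> \<le> x\<^sup>2 / b"
    using False assms mult_left_mono[of b "\<bar>x\<bar>" "\<bar>x\<bar>"]
    by (simp add: field_simps power2_eq_square)
  finally show ?thesis .
qed

text \<open>Each bounded factor multiplies the Lipschitz constant of the other. This is the test
  function to which independence is applied: the first \<open>n\<close> coordinates carry the past,
  the last one the new variable.\<close>

lemma clip_product_C_b_Lip:
  assumes "0 \<le> L" "0 \<le> b" "0 \<le> c"
    and g: "\<And>x y. length x = n \<Longrightarrow> length y = n \<Longrightarrow>
        \<bar>g x - g y\<bar> \<le> L * (\<Sum>i<n. \<bar>x ! i - y ! i\<bar>)"
  shows "(\<lambda>z. clip b (g (take n z)) * clip c (z ! n)) \<in> C_b_Lip (n + 1)"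
  unfolding C_b_Lip_def
proof (intro CollectI conjI)
  have "\<bar>clip b (g (take n x)) * clip c (x ! n)\<bar> \<le> b * c" for x
    unfolding abs_mult by (intro mult_mono abs_clip_le assms) auto
  then show "\<exists>B. \<forall>x. length x = n + 1 \<longrightarrow> \<bar>clip b (g (take n x)) * clip c (x ! n)\<bar> \<le> B"
    by blast
next
  show "\<exists>K. \<forall>x y. length x = n + 1 \<longrightarrow> length y = n + 1 \<longrightarrow>
      \<bar>clip b (g (take n x)) * clip c (x ! n) - clip b (g (take n y)) * clip c (y ! n)\<bar>
        \<le> K * dist_list x y"
  proof (intro exI[of _ "c * (L * n) + b"] allI impI)
    fix x y :: "real list"
    assume xy: "length x = n + 1" "length y = n + 1"
    let ?u = "clip b (g (take n x))" and ?v = "clip c (x ! n)"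
    let ?u' = "clip b (g (take n y))" and ?v' = "clip c (y ! n)"
    have "\<bar>?u - ?u'\<bar> \<le> \<bar>g (take n x) - g (take n y)\<bar>"
      by (rule clip_lipschitz)
    also have "\<dots> \<le> L * (\<Sum>i<n. \<bar>take n x ! i - take n y ! i\<bar>)"
      using xy by (intro g) auto
    also have "\<dots> \<le> L * (n * dist_list x y)"
      using sum_nth_le_dist_list[OF xy, of n] assms by (auto intro!: mult_left_mono)
    finally have u: "\<bar>?u - ?u'\<bar> \<le> L * (n * dist_list x y)" .
    have v: "\<bar>?v - ?v'\<bar> \<le> dist_list x y"
      using clip_lipschitz[of c "x ! n" "y ! n"] dist_list_nth_le[OF xy, of n] by simp
    have "?u * ?v - ?u' * ?v' = ?v * (?u - ?u') + ?u' * (?v - ?v')"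
      by (simp add: algebra_simps)
    then have "\<bar>?u * ?v - ?u' * ?v'\<bar> \<le> \<bar>?v\<bar> * \<bar>?u - ?u'\<bar> + \<bar>?u'\<bar> * \<bar>?v - ?v'\<bar>"
      by (metis abs_mult abs_triangle_ineq)
    also have "\<dots> \<le> c * (L * (n * dist_list x y)) + b * dist_list x y"
      by (intro add_mono mult_mono u v abs_clip_le assms) auto
    finally show "\<bar>?u * ?v - ?u' * ?v'\<bar> \<le> (c * (L * n) + b) * dist_list x y"
      by (simp add: algebra_simps)
  qed
qed

section \<open>Lipschitz functions of a random vector\<close>

text \<open>
  The distance is the \<open>\<ell>\<^sup>1\<close>-distance, which makes the closure properties below immediate.
\<close>

definition lipschitz_of :: "('w \<Rightarrow> real) list \<Rightarrow> ('w \<Rightarrow> real) \<Rightarrow> bool" where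
  "lipschitz_of Xs G \<longleftrightarrow> (\<exists>g L. 0 \<le> L \<and> (\<forall>\<omega>. G \<omega> = g (rvec Xs \<omega>)) \<and>
     (\<forall>x y. length x = length Xs \<longrightarrow> length y = length Xs \<longrightarrow>
        \<bar>g x - g y\<bar> \<le> L * (\<Sum>i<length Xs. \<bar>x ! i - y ! i\<bar>)))"

lemma lipschitz_of_const: "lipschitz_of Xs (\<lambda>\<omega>. c)"
  unfolding lipschitz_of_def by (intro exI[of _ "\<lambda>_. c"] exI[of _ 0]) auto

lemma lipschitz_of_nth:
  assumes "i < length Xs"
  shows "lipschitz_of Xs (Xs ! i)"
  unfolding lipschitz_of_def
proof (intro exI[of _ "\<lambda>x. x ! i"] exI[of _ 1] conjI allI impI)
  fix x y :: "real list"
  show "\<bar>x ! i - y ! i\<bar> \<le> 1 * (\<Sum>i<length Xs. \<bar>x ! i - y ! i\<bar>)"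
    using assms by (auto intro!: member_le_sum[where f = "\<lambda>i. \<bar>x ! i - y ! i\<bar>"])
qed (use assms in \<open>auto simp: rvec_def\<close>)

text \<open>Common source of the closure under sums, maxima and scaling: each is a binary operation
  with a separate Lipschitz constant in each argument.\<close>

lemma lipschitz_of_combine:
  assumes "lipschitz_of Xs G" "lipschitz_of Xs H"
    and h: "\<And>u v u' v'. \<bar>h u v - h u' v'\<bar> \<le> A * \<bar>u - u'\<bar> + B * \<bar>v - v'\<bar>"
    and "0 \<le> A" "0 \<le> B"
  shows "lipschitz_of Xs (\<lambda>\<omega>. h (G \<omega>) (H \<omega>))"
proof -
  obtain g K where g: "0 \<le> K" "\<And>\<omega>. G \<omega> = g (rvec Xs \<omega>)"
    "\<And>x y. length x = length Xs \<Longrightarrow> length y = length Xs \<Longrightarrow>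
        \<bar>g x - g y\<bar> \<le> K * (\<Sum>i<length Xs. \<bar>x ! i - y ! i\<bar>)"
    using assms(1) unfolding lipschitz_of_def by blast
  obtain f L where f: "0 \<le> L" "\<And>\<omega>. H \<omega> = f (rvec Xs \<omega>)"
    "\<And>x y. length x = length Xs \<Longrightarrow> length y = length Xs \<Longrightarrow>
        \<bar>f x - f y\<bar> \<le> L * (\<Sum>i<length Xs. \<bar>x ! i - y ! i\<bar>)"
    using assms(2) unfolding lipschitz_of_def by blast
  show ?thesis
    unfolding lipschitz_of_def
  proof (intro exI[of _ "\<lambda>x. h (g x) (f x)"] exI[of _ "A * K + B * L"] conjI allI impI)
    fix x y :: "real list"
    assume xy: "length x = length Xs" "length y = length Xs"
    let ?d = "\<Sum>i<length Xs. \<bar>x ! i - y ! i\<bar>"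
    have "\<bar>h (g x) (f x) - h (g y) (f y)\<bar> \<le> A * \<bar>g x - g y\<bar> + B * \<bar>f x - f y\<bar>"
      by (rule h)
    also have "\<dots> \<le> A * (K * ?d) + B * (L * ?d)"
      by (intro add_mono mult_left_mono g f xy assms)
    finally show "\<bar>h (g x) (f x) - h (g y) (f y)\<bar> \<le> (A * K + B * L) * ?d"
      by (simp add: algebra_simps)
  qed (use g f assms in auto)
qed

lemma lipschitz_of_add:
  assumes "lipschitz_of Xs G" "lipschitz_of Xs H"
  shows "lipschitz_of Xs (\<lambda>\<omega>. G \<omega> + H \<omega>)"
  by (rule lipschitz_of_combine[OF assms, where A = 1 and B = 1]) auto

lemma lipschitz_of_max:
  assumes "lipschitz_of Xs G" "lipschitz_of Xs H"
  shows "lipschitz_of Xs (\<lambda>\<omega>. max (G \<omega>) (H \<omega>))"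
  by (rule lipschitz_of_combine[OF assms, where A = 1 and B = 1]) (auto simp: max_def)

lemma lipschitz_of_scale:
  assumes "lipschitz_of Xs G"
  shows "lipschitz_of Xs (\<lambda>\<omega>. c * G \<omega>)"
  by (rule lipschitz_of_combine[OF assms assms, where A = "\<bar>c\<bar>" and B = 0 and h = "\<lambda>u v. c * u"])
    (simp_all add: abs_mult flip: right_diff_distrib)

lemma lipschitz_of_sum:
  assumes "\<And>i. i \<in> I \<Longrightarrow> lipschitz_of Xs (G i)"
  shows "lipschitz_of Xs (\<lambda>\<omega>. \<Sum>i\<in>I. G i \<omega>)"
  using assms
  by (induction I rule: infinite_finite_induct) (auto intro: lipschitz_of_const lipschitz_of_add)

section \<open>The running maximum and the pathwise Doob inequality\<close>

primrec run_max :: "(nat \<Rightarrow> real) \<Rightarrow> nat \<Rightarrow> real" where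
  "run_max s 0 = s 0"
| "run_max s (Suc n) = max (s (Suc n)) (run_max s n)"

lemma run_max_ge: "k \<le> n \<Longrightarrow> s k \<le> run_max s n"
  by (induction n) (auto simp: le_Suc_eq max.coboundedI1 max.coboundedI2)

text \<open>Used where the partial sums along a residue class stand still between two consecutive
  members of the class.\<close>

lemma run_max_const: "n \<le> k \<Longrightarrow> (\<And>j. n \<le> j \<Longrightarrow> j \<le> k \<Longrightarrow> s j = s n) \<Longrightarrow> run_max s k = run_max s n"
proof (induction k)
  case (Suc k)
  show ?case
  proof (cases "n = Suc k")
    case False
    then have "n \<le> k" using Suc.prems(1) by simp
    then have "run_max s k = run_max s n" "s (Suc k) = s n"
      by (auto intro!: Suc.IH Suc.prems)
    then show ?thesis using run_max_ge[of n n s] by simp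
  qed simp
qed (metis le_zero_eq)

lemma lipschitz_of_run_max:
  "(\<And>k. k \<le> n \<Longrightarrow> lipschitz_of Xs (s k)) \<Longrightarrow> lipschitz_of Xs (\<lambda>\<omega>. run_max (\<lambda>k. s k \<omega>) n)"
  by (induction n) (auto intro: lipschitz_of_max)

text \<open>
  The pathwise Doob inequality of Acciaio, Beiglboeck, Penkner, Schachermayer and Temme. When
  the running maximum increases it equals the current value, so that summation by parts gives
  \<open>M\<^sub>n\<^sup>2 / 2 \<le> M\<^sub>n s\<^sub>n - \<Sum> M\<^sub>k (s\<^sub>k\<^sub>+\<^sub>1 - s\<^sub>k)\<close>.
\<close>

lemma run_max_doob:
  assumes "s 0 = 0"
  shows "(run_max s n)\<^sup>2 \<le> 4 * (\<Sum>k<n. (s (Suc k) - s k)\<^sup>2)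
    + (\<Sum>k<n. (8 * s k - 4 * run_max s k) * (s (Suc k) - s k))"
proof -
  have by_parts: "(run_max s n)\<^sup>2 / 2 \<le> run_max s n * s n - (\<Sum>k<n. run_max s k * (s (Suc k) - s k))"
  proof (induction n)
    case (Suc n)
    show ?case
    proof (cases "run_max s n \<le> s (Suc n)")
      case True
      have "0 \<le> (s (Suc n) - run_max s n)\<^sup>2" by simp
      then show ?thesis using Suc True by (simp add: max_def algebra_simps power2_eq_square)
    next
      case False
      then show ?thesis using Suc by (simp add: max_def algebra_simps)
    qed
  qed (simp add: assms)
  have square: "(s n)\<^sup>2 = (\<Sum>k<n. (s (Suc k) - s k)\<^sup>2) + 2 * (\<Sum>k<n. s k * (s (Suc k) - s k))"
    by (induction n) (simp_all add: assms algebra_simps power2_eq_square)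
  have "(\<Sum>k<n. (8 * s k - 4 * run_max s k) * (s (Suc k) - s k))
      = 8 * (\<Sum>k<n. s k * (s (Suc k) - s k)) - 4 * (\<Sum>k<n. run_max s k * (s (Suc k) - s k))"
    by (simp add: sum_distrib_left sum_subtractf[symmetric] algebra_simps)
  \<comment> \<open>This is \<open>M s \<le> M\<^sup>2 / 4 + s\<^sup>2\<close> for the maximum
    \<open>M\<close> and the final value \<open>s\<close>. Inserted in \<open>by_parts\<close> it
    leaves \<open>M\<^sup>2 / 4\<close> on the left; multiplying by 4 and expanding
    \<open>s\<^sup>2\<close> by \<open>square\<close> gives the coefficients 4, 8 and -4.\<close>
  moreover have "0 \<le> (run_max s n - 2 * s n)\<^sup>2" by simp
  ultimately show ?thesis
    using by_parts square by (simp add: power2_eq_square algebra_simps)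
qed

section \<open>Closure properties of \<open>H\<close> and elementary rules for
  \<open>E\<close>\<close>

context sublinear_expectation_space
begin

text \<open>One-variable form of \<open>H_comp\<close>. The exponent \<open>q\<close> admits locally
  Lipschitz functions of polynomial growth, so that squares are covered.\<close>

lemma H_fun1:
  assumes "X \<in> H" "0 < C" "\<And>x y :: real. \<bar>f x - f y\<bar> \<le> C * (1 + \<bar>x\<bar> ^ q + \<bar>y\<bar> ^ q) * \<bar>x - y\<bar>"
  shows "(\<lambda>\<omega>. f (X \<omega>)) \<in> H"
proof -
  have "(\<lambda>x. f (x ! 0)) \<in> C_l_Lip (length [X])"
    unfolding C_l_Lip_def
  proof (intro CollectI exI[of _ C] exI[of _ q] conjI allI impI)
    fix x y :: "real list"
    assume xy: "length x = length [X]" "length y = length [X]"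
    have "\<bar>f (x ! 0) - f (y ! 0)\<bar> \<le> C * (1 + \<bar>x ! 0\<bar> ^ q + \<bar>y ! 0\<bar> ^ q) * \<bar>x ! 0 - y ! 0\<bar>"
      by (rule assms)
    also have "\<dots> \<le> C * (1 + norm_list x ^ q + norm_list y ^ q) * dist_list x y"
      using assms(2) xy dist_list_nth_le[of x 1 y 0]
      by (intro mult_mono add_mono power_mono norm_list_nth_le) auto
    finally show "\<bar>f (x ! 0) - f (y ! 0)\<bar>
        \<le> C * (1 + norm_list x ^ q + norm_list y ^ q) * dist_list x y" .
  qed (rule assms)
  from H_comp[OF _ this] assms(1) show ?thesis by (simp add: rvec_def)
qed

lemma H_const: "(\<lambda>\<omega>. c) \<in> H"
  using H_fun1[OF H_zero, of 1 "\<lambda>_. c" 0] by simp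

lemma H_abs: "X \<in> H \<Longrightarrow> (\<lambda>\<omega>. \<bar>X \<omega>\<bar>) \<in> H"
  by (rule H_fun1[where f = abs and C = 1 and q = 0])
    (auto intro: order_trans[OF abs_triangle_ineq3])

lemma H_square:
  assumes "X \<in> H"
  shows "(\<lambda>\<omega>. (X \<omega>)\<^sup>2) \<in> H"
proof (rule H_fun1[OF assms, where C = 1 and q = 1])
  fix x y :: real
  have "\<bar>x\<^sup>2 - y\<^sup>2\<bar> = \<bar>x + y\<bar> * \<bar>x - y\<bar>"
    by (simp add: abs_mult[symmetric] algebra_simps power2_eq_square)
  also have "\<dots> \<le> 1 * (1 + \<bar>x\<bar> ^ 1 + \<bar>y\<bar> ^ 1) * \<bar>x - y\<bar>"
    by (intro mult_right_mono) auto
  finally show "\<bar>x\<^sup>2 - y\<^sup>2\<bar> \<le> 1 * (1 + \<bar>x\<bar> ^ 1 + \<bar>y\<bar> ^ 1) * \<bar>x - y\<bar>" .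
qed simp

lemma H_uminus: "X \<in> H \<Longrightarrow> (\<lambda>\<omega>. - X \<omega>) \<in> H"
  using H_scale[of X "-1"] by simp

lemma H_diff: "X \<in> H \<Longrightarrow> Y \<in> H \<Longrightarrow> (\<lambda>\<omega>. X \<omega> - Y \<omega>) \<in> H"
  using H_add[OF _ H_uminus, of X Y] by simp

text \<open>Polarization reduces products to squares.\<close>

lemma H_mult:
  assumes "X \<in> H" "Y \<in> H"
  shows "(\<lambda>\<omega>. X \<omega> * Y \<omega>) \<in> H"
proof -
  have "(\<lambda>\<omega>. 1/4 * ((X \<omega> + Y \<omega>)\<^sup>2 - (X \<omega> - Y \<omega>)\<^sup>2)) \<in> H"
    by (intro H_scale H_diff H_square H_add assms)
  then show ?thesis by (simp add: power2_eq_square algebra_simps)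
qed

lemma H_max:
  assumes "X \<in> H" "Y \<in> H"
  shows "(\<lambda>\<omega>. max (X \<omega>) (Y \<omega>)) \<in> H"
proof -
  have "(\<lambda>\<omega>. 1/2 * (X \<omega> + Y \<omega> + \<bar>X \<omega> - Y \<omega>\<bar>)) \<in> H"
    by (intro H_scale H_diff H_abs H_add assms)
  moreover have "(\<lambda>\<omega>. 1/2 * (X \<omega> + Y \<omega> + \<bar>X \<omega> - Y \<omega>\<bar>)) = (\<lambda>\<omega>. max (X \<omega>) (Y \<omega>))"
    by (auto simp: max_def fun_eq_iff)
  ultimately show ?thesis by simp
qed

lemma H_clip:
  assumes "X \<in> H"
  shows "(\<lambda>\<omega>. clip b (X \<omega>)) \<in> H"
  by (rule H_fun1[OF assms, where f = "clip b" and C = 1 and q = 0])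
    (auto intro: order_trans[OF clip_lipschitz])

lemma H_sum: "(\<And>i. i \<in> I \<Longrightarrow> X i \<in> H) \<Longrightarrow> (\<lambda>\<omega>. \<Sum>i\<in>I. X i \<omega>) \<in> H"
  by (induction I rule: infinite_finite_induct) (auto intro: H_const H_add)

lemma H_run_max: "(\<And>k. k \<le> n \<Longrightarrow> s k \<in> H) \<Longrightarrow> (\<lambda>\<omega>. run_max (\<lambda>k. s k \<omega>) n) \<in> H"
  by (induction n) (auto intro: H_max)

lemma E_nonneg: "X \<in> H \<Longrightarrow> (\<And>\<omega>. 0 \<le> X \<omega>) \<Longrightarrow> 0 \<le> E X"
  using mono[OF H_const[of 0]] const[of 0] by fastforce

lemma E_sum_le:
  assumes "\<And>i. i \<in> I \<Longrightarrow> X i \<in> H"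
  shows "E (\<lambda>\<omega>. \<Sum>i\<in>I. X i \<omega>) \<le> (\<Sum>i\<in>I. E (X i))"
  using assms
proof (induction I rule: infinite_finite_induct)
  case (insert i I)
  have "E (\<lambda>\<omega>. X i \<omega> + (\<Sum>i\<in>I. X i \<omega>)) \<le> E (X i) + E (\<lambda>\<omega>. \<Sum>i\<in>I. X i \<omega>)"
    by (intro subadd H_sum) (use insert in auto)
  then show ?case using insert by fastforce
qed (auto simp: const)

text \<open>The value is linear in the positive and negative parts of \<open>q\<close>. Hence it
  vanishes when both \<open>Y\<close> and \<open>- Y\<close> have expectation 0, and substituting an
  element of \<open>H\<close> for \<open>q\<close> gives an element of \<open>H\<close>; this makes
  the inner expectation in the independence identity tractable.\<close>

lemma E_mult_const:
  assumes "Y \<in> H"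
  shows "E (\<lambda>\<omega>. q * Y \<omega>) = max q 0 * E Y + max (- q) 0 * E (\<lambda>\<omega>. - Y \<omega>)"
proof (cases "0 \<le> q")
  case True
  then show ?thesis using pos_homogeneous[OF assms True] by simp
next
  case False
  then show ?thesis using pos_homogeneous[OF H_uminus[OF assms], of "- q"] by simp
qed

lemma lipschitz_of_in_H:
  assumes "lipschitz_of Xs G" "set Xs \<subseteq> H"
  shows "G \<in> H"
proof -
  obtain g L where g: "0 \<le> L" "\<And>\<omega>. G \<omega> = g (rvec Xs \<omega>)"
    "\<And>x y. length x = length Xs \<Longrightarrow> length y = length Xs \<Longrightarrow>
        \<bar>g x - g y\<bar> \<le> L * (\<Sum>i<length Xs. \<bar>x ! i - y ! i\<bar>)"
    using assms(1) unfolding lipschitz_of_def by blast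
  let ?n = "length Xs"
  have "g \<in> C_l_Lip ?n"
    unfolding C_l_Lip_def
  \<comment> \<open>The summand 1 keeps the constant positive even if \<open>L\<close> or the
    dimension is 0; exponent 0 suffices for a global Lipschitz bound.\<close>
  proof (intro CollectI exI[of _ "L * ?n + 1"] exI[of _ 0] conjI allI impI)
    fix x y :: "real list"
    assume xy: "length x = ?n" "length y = ?n"
    have "\<bar>g x - g y\<bar> \<le> L * (\<Sum>i<?n. \<bar>x ! i - y ! i\<bar>)"
      by (rule g(3)[OF xy])
    also have "\<dots> \<le> L * (?n * dist_list x y)"
      by (intro mult_left_mono sum_nth_le_dist_list[OF xy] g) auto
    also have "\<dots> \<le> (L * ?n + 1) * 3 * dist_list x y"
      using g(1) mult_nonneg_nonneg[of "L * ?n" "dist_list x y"] by (simp add: algebra_simps)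
    finally show "\<bar>g x - g y\<bar>
      \<le> (L * ?n + 1) * (1 + norm_list x ^ 0 + norm_list y ^ 0) * dist_list x y" by simp
  qed (use g(1) in \<open>simp add: add_nonneg_pos\<close>)
  from H_comp[OF assms(2) this] show ?thesis
    by (simp add: g(2)[symmetric])
qed

section \<open>Products with an independent centred factor\<close>

text \<open>
  Independence only concerns bounded test functions. Truncating \<open>G\<close> at \<open>b\<close> and \<open>Y\<close> at
  \<open>b\<^sup>2\<close> costs \<open>O(1/b)\<close>, because \<open>Y\<^sup>2\<close> and \<open>G\<^sup>2 \<bar>Y\<bar>\<close> have finite expectation.
\<close>

lemma E_mult_indep_le:
  assumes ind: "indep_of E [Y] Xs" and XsH: "set Xs \<subseteq> H" and YH: "Y \<in> H"
    and EY: "E Y = 0" "E (\<lambda>\<omega>. - Y \<omega>) = 0" and G: "lipschitz_of Xs G"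
  shows "E (\<lambda>\<omega>. G \<omega> * Y \<omega>) \<le> 0"
proof -
  have GH: "G \<in> H" by (rule lipschitz_of_in_H[OF G XsH])
  obtain g L where g: "0 \<le> L" "\<And>\<omega>. G \<omega> = g (rvec Xs \<omega>)"
    "\<And>x y. length x = length Xs \<Longrightarrow> length y = length Xs \<Longrightarrow>
        \<bar>g x - g y\<bar> \<le> L * (\<Sum>i<length Xs. \<bar>x ! i - y ! i\<bar>)"
    using G unfolding lipschitz_of_def by blast
  define D where "D = E (\<lambda>\<omega>. (Y \<omega>)\<^sup>2)"
  define F where "F = E (\<lambda>\<omega>. (G \<omega>)\<^sup>2 * \<bar>Y \<omega>\<bar>)"
  note H_intros = H_const H_scale H_square H_abs H_mult H_clip H_add H_diff H_uminus H_max GH YH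
  have trunc: "E (\<lambda>\<omega>. clip b (G \<omega>) * clip (b\<^sup>2) (Y \<omega>)) \<le> D / b" if b: "0 < b" for b
  proof -
    let ?n = "length Xs" and ?Z = "\<lambda>\<omega>. clip (b\<^sup>2) (Y \<omega>)"
    let ?\<phi> = "\<lambda>z. clip b (g (take ?n z)) * clip (b\<^sup>2) (z ! ?n)"
    have ZH: "?Z \<in> H" by (intro H_intros)
    \<comment> \<open>Here \<open>q\<close> is a frozen value of the clipped \<open>G\<close>. Since
      \<open>q * Y\<close> has expectation 0, only the error of clipping \<open>Y\<close> is left,
      and level \<open>b\<^sup>2\<close> turns it into
      \<open>b * Y\<^sup>2 / b\<^sup>2\<close>.\<close>
    have inner: "E (\<lambda>\<omega>. q * ?Z \<omega>) \<le> D / b" if q: "\<bar>q\<bar> \<le> b" for q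
    proof -
      have "E (\<lambda>\<omega>. q * ?Z \<omega>) \<le> E (\<lambda>\<omega>. q * Y \<omega> + 1 / b * (Y \<omega>)\<^sup>2)"
      proof (rule mono)
        fix \<omega>
        have "q * ?Z \<omega> - q * Y \<omega> \<le> \<bar>q\<bar> * \<bar>Y \<omega> - ?Z \<omega>\<bar>"
          by (metis abs_ge_self abs_minus_commute abs_mult right_diff_distrib)
        also have "\<dots> \<le> b * ((Y \<omega>)\<^sup>2 / b\<^sup>2)"
          by (intro mult_mono q clip_error) (use b in auto)
        also have "\<dots> = 1 / b * (Y \<omega>)\<^sup>2"
          using b by (simp add: power2_eq_square)
        finally show "q * ?Z \<omega> \<le> q * Y \<omega> + 1 / b * (Y \<omega>)\<^sup>2" by simp
      qed (intro H_intros)+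
      also have "\<dots> \<le> E (\<lambda>\<omega>. q * Y \<omega>) + E (\<lambda>\<omega>. 1 / b * (Y \<omega>)\<^sup>2)"
        by (intro subadd) (intro H_intros)+
      also have "\<dots> = D / b"
        using pos_homogeneous[OF H_square[OF YH], of "1 / b"] b EY
        by (simp add: E_mult_const[OF YH] D_def)
      finally show ?thesis .
    qed
    have "?\<phi> \<in> C_b_Lip (length Xs + length [Y])"
      using clip_product_C_b_Lip[OF g(1), of b "b\<^sup>2" ?n g] g(3) b by simp
    from bspec[OF ind[unfolded indep_of_def] this]
    have "E (\<lambda>\<omega>. clip b (G \<omega>) * ?Z \<omega>) = E (\<lambda>\<omega>. E (\<lambda>\<omega>'. clip b (G \<omega>) * ?Z \<omega>'))"
      by (simp add: rvec_def g(2) nth_append)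
    also have "\<dots> \<le> E (\<lambda>\<omega>. D / b)"
    proof (rule mono)
      \<comment> \<open>Monotonicity of \<open>E\<close> holds on \<open>H\<close> only, so the
        inner expectation must first be recognised as an element of \<open>H\<close>, through its
        explicit form.\<close>
      have "(\<lambda>\<omega>. E ?Z * max (clip b (G \<omega>)) 0 + E (\<lambda>\<omega>. - ?Z \<omega>) * max (- clip b (G \<omega>)) 0) \<in> H"
        by (intro H_intros)
      then show "(\<lambda>\<omega>. E (\<lambda>\<omega>'. clip b (G \<omega>) * ?Z \<omega>')) \<in> H"
        by (simp add: E_mult_const[OF ZH] mult.commute)
    qed (use inner b abs_clip_le H_const in \<open>auto simp: less_imp_le\<close>)
    finally show ?thesis by (simp add: const)
  qed
  \<comment> \<open>\<open>F / b\<close> is the cost of clipping \<open>G\<close>; one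
    \<open>D / b\<close> is the cost of clipping \<open>Y\<close>, the other comes from
    \<open>trunc\<close>.\<close>
  have bound: "E (\<lambda>\<omega>. G \<omega> * Y \<omega>) \<le> (2 * D + F) / b" if b: "0 < b" for b
  proof -
    let ?P = "\<lambda>\<omega>. clip b (G \<omega>) * clip (b\<^sup>2) (Y \<omega>)"
    let ?Q = "\<lambda>\<omega>. 1 / b * ((G \<omega>)\<^sup>2 * \<bar>Y \<omega>\<bar>)"
    let ?R = "\<lambda>\<omega>. 1 / b * (Y \<omega>)\<^sup>2"
    have PH: "?P \<in> H" and QH: "?Q \<in> H" and RH: "?R \<in> H"
      by (intro H_intros)+
    have "E (\<lambda>\<omega>. G \<omega> * Y \<omega>) \<le> E (\<lambda>\<omega>. ?P \<omega> + (?Q \<omega> + ?R \<omega>))"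
    proof (rule mono)
      fix \<omega>
      let ?g = "G \<omega>" and ?y = "Y \<omega>"
      have "?g * ?y - ?P \<omega> = (?g - clip b ?g) * ?y + clip b ?g * (?y - clip (b\<^sup>2) ?y)"
        by (simp add: algebra_simps)
      also have "\<dots> \<le> \<bar>?g - clip b ?g\<bar> * \<bar>?y\<bar> + \<bar>clip b ?g\<bar> * \<bar>?y - clip (b\<^sup>2) ?y\<bar>"
        by (intro add_mono) (metis abs_ge_self abs_mult)+
      also have "\<dots> \<le> ?g\<^sup>2 / b * \<bar>?y\<bar> + b * (?y\<^sup>2 / b\<^sup>2)"
        by (intro add_mono mult_mono clip_error abs_clip_le) (use b in auto)
      also have "\<dots> = ?Q \<omega> + ?R \<omega>"
        using b by (simp add: power2_eq_square)
      finally show "?g * ?y \<le> ?P \<omega> + (?Q \<omega> + ?R \<omega>)" by simp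
    qed (intro H_intros)+
    also have "\<dots> \<le> E ?P + (E ?Q + E ?R)"
      using subadd[OF PH H_add[OF QH RH]] subadd[OF QH RH] by linarith
    also have "E ?Q = F / b"
      using pos_homogeneous[of "\<lambda>\<omega>. (G \<omega>)\<^sup>2 * \<bar>Y \<omega>\<bar>" "1 / b"] b H_mult[OF H_square[OF GH] H_abs[OF YH]]
      by (simp add: F_def)
    also have "E ?R = D / b"
      using pos_homogeneous[OF H_square[OF YH], of "1 / b"] b by (simp add: D_def)
    finally show ?thesis
      using trunc[OF b] by (simp add: add_divide_distrib)
  qed
  have "((\<lambda>b. (2 * D + F) / b) \<longlongrightarrow> 0) at_top"
    by (rule tendsto_divide_0[OF tendsto_const]) (simp add: filterlim_at_top_imp_at_infinity filterlim_ident)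
  moreover have "\<forall>\<^sub>F b in at_top. E (\<lambda>\<omega>. G \<omega> * Y \<omega>) \<le> (2 * D + F) / b"
    using eventually_gt_at_top[of 0] by eventually_elim (rule bound)
  ultimately show ?thesis
    by (rule tendsto_lowerbound) simp
qed

section \<open>Maximal inequalities\<close>

text \<open>Subadditivity is applied to the right-hand side of the pathwise Doob inequality. The
  assumption \<open>orth\<close> takes the place of the martingale property.\<close>

lemma E_run_max_le:
  fixes Y :: "nat \<Rightarrow> 'w \<Rightarrow> real"
  defines "s \<equiv> \<lambda>\<omega> n. \<Sum>i<n. Y i \<omega>"
  assumes YH: "\<And>i. Y i \<in> H"
    and orth: "\<And>k. E (\<lambda>\<omega>. (8 * s \<omega> k - 4 * run_max (s \<omega>) k) * Y k \<omega>) \<le> 0"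
  shows "(\<lambda>\<omega>. (run_max (s \<omega>) n)\<^sup>2) \<in> H"
    and "E (\<lambda>\<omega>. (run_max (s \<omega>) n)\<^sup>2) \<le> 4 * (\<Sum>i<n. E (\<lambda>\<omega>. (Y i \<omega>)\<^sup>2))"
proof -
  have sH: "(\<lambda>\<omega>. s \<omega> k) \<in> H" for k
    unfolding s_def by (intro H_sum YH)
  have MH: "(\<lambda>\<omega>. run_max (s \<omega>) k) \<in> H" for k
    using H_run_max[of k "\<lambda>k \<omega>. s \<omega> k"] sH by simp
  show H: "(\<lambda>\<omega>. (run_max (s \<omega>) n)\<^sup>2) \<in> H"
    by (intro H_square MH)
  let ?P = "\<lambda>\<omega>. 4 * (\<Sum>i<n. (Y i \<omega>)\<^sup>2)"
  let ?Q = "\<lambda>\<omega>. \<Sum>k<n. (8 * s \<omega> k - 4 * run_max (s \<omega>) k) * Y k \<omega>"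
  have SH: "(\<lambda>\<omega>. \<Sum>i<n. (Y i \<omega>)\<^sup>2) \<in> H"
    by (intro H_sum H_square YH)
  have PH: "?P \<in> H" by (intro H_scale SH)
  have TH: "(\<lambda>\<omega>. (8 * s \<omega> k - 4 * run_max (s \<omega>) k) * Y k \<omega>) \<in> H" for k
    by (intro H_mult H_diff H_scale sH MH YH)
  have QH: "?Q \<in> H" by (intro H_sum TH)
  have "E (\<lambda>\<omega>. (run_max (s \<omega>) n)\<^sup>2) \<le> E (\<lambda>\<omega>. ?P \<omega> + ?Q \<omega>)"
  proof (rule mono[OF H H_add[OF PH QH]])
    fix \<omega>
    have "s \<omega> (Suc k) - s \<omega> k = Y k \<omega>" for k by (simp add: s_def)
    then show "(run_max (s \<omega>) n)\<^sup>2 \<le> ?P \<omega> + ?Q \<omega>"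
      using run_max_doob[of "s \<omega>" n] by (simp add: s_def)
  qed
  also have "\<dots> \<le> E ?P + E ?Q"
    by (rule subadd[OF PH QH])
  also have "E ?P \<le> 4 * (\<Sum>i<n. E (\<lambda>\<omega>. (Y i \<omega>)\<^sup>2))"
    using pos_homogeneous[OF SH, of 4] E_sum_le[of "{..<n}" "\<lambda>i \<omega>. (Y i \<omega>)\<^sup>2"] H_square[OF YH]
    by auto
  also have "E ?Q \<le> (\<Sum>k<n. E (\<lambda>\<omega>. (8 * s \<omega> k - 4 * run_max (s \<omega>) k) * Y k \<omega>))"
    by (intro E_sum_le TH)
  also have "\<dots> \<le> 0"
    by (intro sum_nonpos orth)
  finally show "E (\<lambda>\<omega>. (run_max (s \<omega>) n)\<^sup>2) \<le> 4 * (\<Sum>i<n. E (\<lambda>\<omega>. (Y i \<omega>)\<^sup>2))"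
    by simp
qed

text \<open>The infimum is a real one, so boundedness from below has to be checked; it follows by
  comparing each admissible \<open>\<xi>\<close> with 0.\<close>

lemma capacity_le:
  assumes "\<xi> \<in> H" "\<And>\<omega>. \<omega> \<in> space M \<Longrightarrow> indicator A \<omega> \<le> \<xi> \<omega>"
  shows "capacity M H E A \<le> E \<xi>"
  unfolding capacity_def
proof (rule cInf_lower)
  show "bdd_below {E \<xi> |\<xi>. \<xi> \<in> H \<and> (\<forall>\<omega>\<in>space M. indicator A \<omega> \<le> \<xi> \<omega>)}"
  proof (rule bdd_belowI[of _ 0])
    fix e assume "e \<in> {E \<xi> |\<xi>. \<xi> \<in> H \<and> (\<forall>\<omega>\<in>space M. indicator A \<omega> \<le> \<xi> \<omega>)}"
    then obtain \<xi> where \<xi>: "e = E \<xi>" "\<xi> \<in> H" "\<And>\<omega>. \<omega> \<in> space M \<Longrightarrow> indicator A \<omega> \<le> \<xi> \<omega>"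
      by blast
    have "E (\<lambda>\<omega>. 0) \<le> E \<xi>"
      by (rule mono[OF H_zero \<xi>(2)]) (metis \<xi>(3) indicator_pos_le order_trans)
    then show "0 \<le> e" by (simp add: const \<xi>(1))
  qed
qed (use assms in blast)

text \<open>
  Only indices \<open>\<equiv> r\<close> modulo \<open>m + 1\<close> are kept, so that each nonzero increment is independent of
  all the preceding ones. The sign \<open>c = -1\<close> serves to bound the running minimum.
\<close>

lemma E_run_max_residue_le:
  fixes X :: "nat \<Rightarrow> 'w \<Rightarrow> real" and c :: real and m r :: nat
  defines "Y \<equiv> \<lambda>i \<omega>. if Suc i mod (m + 1) = r then c * X (Suc i) \<omega> else 0"
  defines "s \<equiv> \<lambda>\<omega> n. \<Sum>i<n. Y i \<omega>"
  assumes XH: "\<And>n. n \<ge> 1 \<Longrightarrow> X n \<in> H"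
    and dep: "m_dependent E m X"
    and EX: "\<And>n. n \<ge> 1 \<Longrightarrow> E (X n) = 0" "\<And>n. n \<ge> 1 \<Longrightarrow> E (\<lambda>\<omega>. - X n \<omega>) = 0"
    and c: "c\<^sup>2 = 1"
  shows "(\<lambda>\<omega>. (run_max (s \<omega>) N)\<^sup>2) \<in> H"
    and "E (\<lambda>\<omega>. (run_max (s \<omega>) N)\<^sup>2) \<le> 4 * (\<Sum>i<N. E (\<lambda>\<omega>. (X (Suc i) \<omega>)\<^sup>2))"
proof -
  have YH: "Y i \<in> H" for i
    unfolding Y_def using H_scale[OF XH[of "Suc i"], of c] H_zero
    by (cases "Suc i mod (m + 1) = r") auto
  have orth: "E (\<lambda>\<omega>. (8 * s \<omega> k - 4 * run_max (s \<omega>) k) * Y k \<omega>) \<le> 0" for k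
  proof (cases "Suc k mod (m + 1) = r")
    case False
    then show ?thesis by (simp add: Y_def const)
  next
    case r: True
    \<comment> \<open>\<open>X (Suc k)\<close> is independent of \<open>X 1, ..., X (k - m)\<close>,
      because \<open>Suc k = (k - m) + m + 1\<close> for \<open>k > m\<close>. For
      \<open>k \<le> m\<close> the difference is cut off at 0.\<close>
    let ?n = "k - m"
    \<comment> \<open>An index \<open>i\<close> with \<open>k - m \<le> i < k\<close> differs from
      \<open>k\<close> by at most \<open>m\<close>, hence lies in another residue class and
      contributes 0.\<close>
    have gap: "s \<omega> j = s \<omega> ?n" if j: "?n \<le> j" "j \<le> k" for j \<omega>
      unfolding s_def
    proof (rule sum.mono_neutral_right)
      show "\<forall>i\<in>{..<j} - {..<?n}. Y i \<omega> = 0"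
      proof
        fix i assume i: "i \<in> {..<j} - {..<?n}"
        then have "i < k" "k - i \<le> m" using j by auto
        then have "\<not> m + 1 dvd Suc k - Suc i"
          using nat_dvd_not_less[of "Suc k - Suc i" "m + 1"] by auto
        then have "Suc k mod (m + 1) \<noteq> Suc i mod (m + 1)"
          using mod_eq_dvd_iff_nat[of "Suc i" "Suc k" "m + 1"] \<open>i < k\<close> by simp
        then show "Y i \<omega> = 0" using r by (simp add: Y_def)
      qed
    qed (use j in auto)
    have s_eq: "s \<omega> k = s \<omega> ?n" for \<omega>
      by (rule gap) auto
    have M_eq: "run_max (s \<omega>) k = run_max (s \<omega>) ?n" for \<omega>
      by (rule run_max_const) (auto intro: gap)
    show ?thesis
    \<comment> \<open>Dependence is only specified for \<open>n \<ge> 1\<close>. In the case 0 the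
      coefficient is \<open>8 * s \<omega> 0 - 4 * s \<omega> 0\<close>, where
      \<open>s \<omega> 0\<close> is an empty sum.\<close>
    proof (cases "?n = 0")
      case True
      then show ?thesis by (simp add: s_eq M_eq) (simp add: s_def const)
    next
      case False
      then have n: "1 \<le> ?n" "Suc k = ?n + m + 1" by auto
      let ?Xs = "map X [1..<?n + 1]"
      \<comment> \<open>The choice \<open>j = m + 1\<close> shrinks the future vector to a single
        variable.\<close>
      have "indep_of E (map X [?n + m + 1..<?n + (m + 1) + 1]) ?Xs"
        using dep n(1) unfolding m_dependent_def by blast
      moreover have "map X [p..<p + 1] = [X p]" for p by simp
      from this[of "?n + m + 1"]
      have "map X [?n + m + 1..<?n + (m + 1) + 1] = [X (Suc k)]"
        by (simp only: n(2) add.assoc)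
      ultimately have ind: "indep_of E [X (Suc k)] ?Xs"
        by (simp only:)
      have XsH: "set ?Xs \<subseteq> H" using XH by auto
      have lipX: "lipschitz_of ?Xs (X (Suc i))" if "i < ?n" for i
        using lipschitz_of_nth[of i ?Xs] that by (simp del: upt_Suc)
      have lipY: "lipschitz_of ?Xs (Y i)" if "i < ?n" for i
        using lipschitz_of_scale[OF lipX[OF that], of c] lipschitz_of_const[of ?Xs 0]
        by (cases "Suc i mod (m + 1) = r") (simp_all add: Y_def del: upt_Suc)
      have lips: "lipschitz_of ?Xs (\<lambda>\<omega>. s \<omega> j)" if "j \<le> ?n" for j
        unfolding s_def using that by (intro lipschitz_of_sum lipY) auto
      \<comment> \<open>The sign \<open>c\<close> is moved from the increment into the Lipschitz
        factor, so that the other factor is \<open>X (Suc k)\<close> itself.\<close>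
      have "lipschitz_of ?Xs (\<lambda>\<omega>. c * (8 * s \<omega> ?n + - 4 * run_max (\<lambda>j. s \<omega> j) ?n))"
        by (intro lipschitz_of_add lipschitz_of_scale lipschitz_of_run_max lips) auto
      from E_mult_indep_le[OF ind XsH XH EX this]
      show ?thesis using r by (simp add: s_eq M_eq Y_def mult_ac)
    qed
  qed
  show "(\<lambda>\<omega>. (run_max (s \<omega>) N)\<^sup>2) \<in> H"
    using E_run_max_le(1)[of Y N] YH orth by (simp add: s_def)
  have "E (\<lambda>\<omega>. (run_max (s \<omega>) N)\<^sup>2) \<le> 4 * (\<Sum>i<N. E (\<lambda>\<omega>. (Y i \<omega>)\<^sup>2))"
    using E_run_max_le(2)[of Y N] YH orth by (simp add: s_def)
  also have "\<dots> \<le> 4 * (\<Sum>i<N. E (\<lambda>\<omega>. (X (Suc i) \<omega>)\<^sup>2))"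
  proof (intro mult_left_mono sum_mono)
    fix i
    show "E (\<lambda>\<omega>. (Y i \<omega>)\<^sup>2) \<le> E (\<lambda>\<omega>. (X (Suc i) \<omega>)\<^sup>2)"
      using E_nonneg[OF H_square[OF XH[of "Suc i"]]] c
      by (cases "Suc i mod (m + 1) = r") (simp_all add: Y_def power_mult_distrib const)
  qed simp
  finally show "E (\<lambda>\<omega>. (run_max (s \<omega>) N)\<^sup>2) \<le> 4 * (\<Sum>i<N. E (\<lambda>\<omega>. (X (Suc i) \<omega>)\<^sup>2))" .
qed

text \<open>Chebyshev's argument for each residue class and each sign. The constant is 4 from Doob,
  2 for the signs, \<open>m + 1\<close> for the number of classes, and
  \<open>(m + 1)\<^sup>2\<close> because each class has to exceed only
  \<open>t / (m + 1)\<close>.\<close>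

lemma maximal_inequality:
  fixes X :: "nat \<Rightarrow> 'w \<Rightarrow> real"
  assumes XH: "\<And>n. n \<ge> 1 \<Longrightarrow> X n \<in> H"
    and dep: "m_dependent E m X"
    and EX: "\<And>n. n \<ge> 1 \<Longrightarrow> E (X n) = 0" "\<And>n. n \<ge> 1 \<Longrightarrow> E (\<lambda>\<omega>. - X n \<omega>) = 0"
    and t: "0 < t"
    and A: "\<And>\<omega>. \<omega> \<in> A \<Longrightarrow> \<exists>n\<le>N. t < \<bar>\<Sum>i<n. X (Suc i) \<omega>\<bar>"
  shows "capacity M H E A \<le> 8 * real (m + 1) ^ 3 / t\<^sup>2 * (\<Sum>i<N. E (\<lambda>\<omega>. (X (Suc i) \<omega>)\<^sup>2))"
proof -
  define Y where "Y c r i \<omega> = (if Suc i mod (m + 1) = r then c * X (Suc i) \<omega> else 0)"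
    for c :: real and r i \<omega>
  define s where "s c r \<omega> n = (\<Sum>i<n. Y c r i \<omega>)" for c r \<omega> n
  define Q where "Q c r \<omega> = (run_max (s c r \<omega>) N)\<^sup>2" for c r \<omega>
  define V where "V = (\<Sum>i<N. E (\<lambda>\<omega>. (X (Suc i) \<omega>)\<^sup>2))"
  define C where "C = real (m + 1) ^ 2 / t\<^sup>2"
  have C: "0 < C" using t by (simp add: C_def)
  have Q: "Q c r \<in> H" "E (Q c r) \<le> 4 * V" if "c\<^sup>2 = 1" for c r
    using E_run_max_residue_le[OF XH dep EX that, of r N]
    by (simp_all add: Q_def[abs_def] s_def[abs_def] Y_def V_def)
  \<comment> \<open>Both signs occur since a running maximum controls only upward excursions. All
    summands are nonnegative, so on \<open>A\<close> a single one reaching 1 is enough.\<close>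
  let ?\<xi> = "\<lambda>\<omega>. \<Sum>r\<le>m. C * (Q 1 r \<omega> + Q (-1) r \<omega>)"
  have TH: "(\<lambda>\<omega>. C * (Q 1 r \<omega> + Q (-1) r \<omega>)) \<in> H" for r
    by (intro H_scale H_add Q) auto
  have nonneg: "0 \<le> C * (Q 1 r \<omega> + Q (-1) r \<omega>)" for r \<omega>
    using C by (simp add: Q_def)
  have "capacity M H E A \<le> E ?\<xi>"
  proof (rule capacity_le)
    show "?\<xi> \<in> H" by (intro H_sum TH)
    fix \<omega>
    show "indicator A \<omega> \<le> ?\<xi> \<omega>"
    proof (cases "\<omega> \<in> A")
      case True
      then obtain n where n: "n \<le> N" "t < \<bar>\<Sum>i<n. X (Suc i) \<omega>\<bar>"
        using A by blast
      have "(\<Sum>r\<le>m. s 1 r \<omega> n) = (\<Sum>i<n. \<Sum>r\<le>m. Y 1 r i \<omega>)"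
        unfolding s_def by (rule sum.swap)
      also have "\<dots> = (\<Sum>i<n. X (Suc i) \<omega>)"
        using less_Suc_eq_le by (auto simp: Y_def intro!: sum.cong)
      finally have split: "(\<Sum>i<n. X (Suc i) \<omega>) = (\<Sum>r\<le>m. s 1 r \<omega> n)" by simp
      \<comment> \<open>Pigeonhole: if all \<open>m + 1\<close> class sums were at most
        \<open>t / (m + 1)\<close> in modulus, the full sum would be at most
        \<open>t\<close>.\<close>
      have "\<exists>r\<le>m. t / real (m + 1) < \<bar>s 1 r \<omega> n\<bar>"
      proof (rule ccontr)
        assume "\<not> ?thesis"
        then have "(\<Sum>r\<le>m. \<bar>s 1 r \<omega> n\<bar>) \<le> real (card {..m}) * (t / real (m + 1))"
          by (intro sum_bounded_above) (auto simp: not_less)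
        then have "\<bar>\<Sum>r\<le>m. s 1 r \<omega> n\<bar> \<le> t"
          using sum_abs[of "\<lambda>r. s 1 r \<omega> n" "{..m}"] by (simp del: sum_abs)
        then show False using n split by simp
      qed
      then obtain r where r: "r \<le> m" "t / real (m + 1) < \<bar>s 1 r \<omega> n\<bar>" by blast
      have neg: "s (-1) r \<omega> n = - s 1 r \<omega> n"
        unfolding s_def sum_negf[symmetric] by (auto simp: Y_def intro: sum.cong)
      obtain c where c: "c = 1 \<or> c = -1" "t / real (m + 1) \<le> s c r \<omega> n"
        using r(2) neg by (cases "0 \<le> s 1 r \<omega> n") (auto intro: that)
      have "(t / real (m + 1))\<^sup>2 \<le> Q c r \<omega>"
        unfolding Q_def using c(2) run_max_ge[OF n(1), of "s c r \<omega>"] t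
        by (intro power_mono) auto
      then have "(t / real (m + 1))\<^sup>2 \<le> Q 1 r \<omega> + Q (-1) r \<omega>"
        using c(1) by (auto simp: Q_def intro: add_increasing add_increasing2)
      then have "C * (t / real (m + 1))\<^sup>2 \<le> C * (Q 1 r \<omega> + Q (-1) r \<omega>)"
        using C by simp
      moreover have "C * (t / real (m + 1))\<^sup>2 = 1"
        using t by (simp add: C_def power_divide)
      moreover have "C * (Q 1 r \<omega> + Q (-1) r \<omega>) \<le> ?\<xi> \<omega>"
        using r(1) nonneg
        by (intro member_le_sum[where f = "\<lambda>r. C * (Q 1 r \<omega> + Q (-1) r \<omega>)"]) auto
      ultimately show ?thesis using True by simp
    next
      case False
      then show ?thesis using nonneg by (simp add: sum_nonneg)
    qed
  qed
  also have "\<dots> \<le> (\<Sum>r\<le>m. E (\<lambda>\<omega>. C * (Q 1 r \<omega> + Q (-1) r \<omega>)))"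
    by (intro E_sum_le TH)
  also have "\<dots> \<le> (\<Sum>r\<le>m. C * (8 * V))"
  proof (rule sum_mono)
    fix r
    have "E (\<lambda>\<omega>. C * (Q 1 r \<omega> + Q (-1) r \<omega>)) = C * E (\<lambda>\<omega>. Q 1 r \<omega> + Q (-1) r \<omega>)"
      using C by (intro pos_homogeneous H_add Q) auto
    also have "\<dots> \<le> C * (8 * V)"
      using subadd[OF Q(1) Q(1), of 1 "-1" r r] Q(2)[of 1 r] Q(2)[of "-1" r] C
      by (intro mult_left_mono) auto
    finally show "E (\<lambda>\<omega>. C * (Q 1 r \<omega> + Q (-1) r \<omega>)) \<le> C * (8 * V)" .
  qed
  also have "\<dots> = 8 * real (m + 1) ^ 3 / t\<^sup>2 * V"
    by (simp add: C_def power3_eq_cube power2_eq_square)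
  finally show ?thesis by (simp add: V_def)
qed

end

section \<open>Dyadic summation and covering by countably many events\<close>

text \<open>A geometric series dominated by its first active term: that term is at most
  \<open>4 / x\<^sup>2\<close>, and the ratio 1/4 contributes the factor 4/3.\<close>

lemma sum_quarter_power_le:
  assumes "0 < (x :: real)"
  shows "(\<Sum>k<K. if x < 2 ^ Suc k then (1/4) ^ k else 0) \<le> (16/3) / x\<^sup>2"
proof -
  have inv: "x\<^sup>2 / 4 ^ k \<le> 4" if "x < 2 ^ Suc k" for k
  proof -
    have "x\<^sup>2 \<le> (2 ^ Suc k)\<^sup>2" using assms that by (intro power_mono) auto
    also have "(2 ^ Suc k)\<^sup>2 = (4 :: real) ^ Suc k" by (simp add: power2_eq_square flip: power_mult_distrib)
    finally show ?thesis by (simp add: field_simps)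
  qed
  \<comment> \<open>Strengthened for the induction: the remaining geometric tail
    \<open>(4/3) * (1/4) ^ K\<close> is subtracted, and the sum is 0 before the first active
    term.\<close>
  have "(\<Sum>k<K. if x < 2 ^ Suc k then (1/4) ^ k else 0)
      \<le> (if x < 2 ^ K then (16/3) / x\<^sup>2 - (4/3) * (1/4) ^ K else 0)"
  proof (induction K)
    case (Suc K)
    have "(4/3) * (1/4) ^ K \<le> (16/3) / x\<^sup>2" if "x < 2 ^ Suc K"
      using inv[OF that] assms by (simp add: field_simps)
    moreover have "x < 2 ^ Suc K" if "x < 2 ^ K"
      using that by (rule less_le_trans) simp
    ultimately show ?case using Suc by (auto split: if_splits)
  next
    case 0
    show ?case
      using inv[of 0] assms power_strict_mono[of x 1 2] by (auto simp: field_simps)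
  qed
  also have "\<dots> \<le> (16/3) / x\<^sup>2" by simp
  finally show ?thesis .
qed

text \<open>Covers are single sequences, so the double family is enumerated by
  \<open>prod_decode\<close>; in \<open>ennreal\<close> the sum may then be iterated.\<close>

lemma outer_capacity_le_double_sum:
  assumes "\<And>j k. B j k \<in> sets M" "A \<subseteq> (\<Union>j k. B j k)"
  shows "outer_capacity M H E A \<le> (\<Sum>j. \<Sum>k. ennreal (capacity M H E (B j k)))"
proof -
  let ?B = "\<lambda>n. case prod_decode n of (j, k) \<Rightarrow> B j k"
  have "outer_capacity M H E A \<le> (\<Sum>n. ennreal (capacity M H E (?B n)))"
    unfolding outer_capacity_def
  proof (rule Inf_lower, intro CollectI exI conjI allI)
    show "A \<subseteq> (\<Union>n. ?B n)"
    proof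
      fix \<omega> assume "\<omega> \<in> A"
      then obtain j k where "\<omega> \<in> B j k" using assms(2) by blast
      then have "\<omega> \<in> ?B (prod_encode (j, k))" by simp
      then show "\<omega> \<in> (\<Union>n. ?B n)" by (rule UN_I[OF UNIV_I])
    qed
  qed (use assms(1) in \<open>auto split: prod.split\<close>)
  also have "\<dots> = (\<Sum>n. (\<lambda>(j, k). ennreal (capacity M H E (B j k))) (prod_decode n))"
    by (simp add: case_prod_beta)
  also have "\<dots> = (\<Sum>j. \<Sum>k. ennreal (capacity M H E (B j k)))"
    by (rule suminf_ennreal_2dimen) simp
  finally show ?thesis .
qed

text \<open>A Borel-Cantelli argument for countably many sequences of events at once. The start
  \<open>K j\<close> of the tail is chosen so that the \<open>j\<close>-th tail costs less than
  \<open>\<delta> / 2 ^ (j + 1)\<close>; since \<open>A\<close> is assumed to be covered for every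
  choice of \<open>K\<close>, the total cost is at most \<open>\<delta>\<close>.\<close>

lemma outer_capacity_zeroI:
  fixes c :: "nat \<Rightarrow> nat \<Rightarrow> real"
  assumes B: "\<And>j k. B j k \<in> sets M"
    and le: "\<And>j k. capacity M H E (B j k) \<le> c j k"
    and c: "\<And>j. summable (c j)" "\<And>j k. 0 \<le> c j k"
    and A: "\<And>\<omega> K. \<omega> \<in> A \<Longrightarrow> \<exists>j. \<exists>k\<ge>K j. \<omega> \<in> B j k"
  shows "outer_capacity M H E A = 0"
proof -
  have "outer_capacity M H E A \<le> 0 + ennreal \<delta>" if \<delta>: "0 < \<delta>" for \<delta>
  proof -
    have "\<exists>K. \<bar>\<Sum>k. c j (k + K)\<bar> < \<delta> * (1/2) ^ Suc j" for j
      using suminf_exist_split[OF _ c(1)[of j], of "\<delta> * (1/2) ^ Suc j"] \<delta> by fastforce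
    then obtain K where K: "\<And>j. \<bar>\<Sum>k. c j (k + K j)\<bar> < \<delta> * (1/2) ^ Suc j"
      by metis
    have "outer_capacity M H E A \<le> (\<Sum>j. \<Sum>k. ennreal (capacity M H E (B j (k + K j))))"
    proof (rule outer_capacity_le_double_sum)
      show "A \<subseteq> (\<Union>j k. B j (k + K j))"
      proof
        fix \<omega> assume "\<omega> \<in> A"
        then obtain j k where "K j \<le> k" "\<omega> \<in> B j k" using A[of \<omega> K] by blast
        then have "\<omega> \<in> B j ((k - K j) + K j)" by simp
        then show "\<omega> \<in> (\<Union>j k. B j (k + K j))" by blast
      qed
    qed (rule B)
    also have "\<dots> \<le> (\<Sum>j. ennreal (\<delta> * (1/2) ^ Suc j))"
    proof (intro suminf_le summableI)
      fix j
      have "(\<Sum>k. ennreal (capacity M H E (B j (k + K j)))) \<le> (\<Sum>k. ennreal (c j (k + K j)))"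
        by (intro suminf_le summableI ennreal_leI le)
      also have "\<dots> = ennreal (\<Sum>k. c j (k + K j))"
        using c by (intro suminf_ennreal2) auto
      also have "\<dots> \<le> ennreal (\<delta> * (1/2) ^ Suc j)"
        using K[of j] by (intro ennreal_leI) auto
      finally show "(\<Sum>k. ennreal (capacity M H E (B j (k + K j)))) \<le> ennreal (\<delta> * (1/2) ^ Suc j)" .
    qed
    also have "\<dots> = ennreal (\<Sum>j. \<delta> * (1/2) ^ Suc j)"
      using \<delta> power_half_series by (intro suminf_ennreal2 summable_mult) (auto simp: sums_iff)
    also have "(\<Sum>j. \<delta> * (1/2) ^ Suc j) = \<delta>"
      using sums_mult[OF power_half_series, of \<delta>] by (simp add: sums_iff)
    finally show ?thesis by simp
  qed
  then have "outer_capacity M H E A \<le> 0"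
    by (rule ennreal_le_epsilon)
  then show ?thesis by simp
qed

theorem theorem4p1:
  fixes M :: "'w measure"
    and H :: "('w \<Rightarrow> real) set"
    and E :: "('w \<Rightarrow> real) \<Rightarrow> real"
    and X :: "nat \<Rightarrow> 'w \<Rightarrow> real"
    and S :: "nat \<Rightarrow> 'w \<Rightarrow> real"
    and a :: "nat \<Rightarrow> real"
    and m :: nat
  assumes "sublinear_expectation_space M H E"
    and "\<And>n. n \<ge> 1 \<Longrightarrow> X n \<in> H"
    and "m_dependent E m X"
    and "\<And>n. n \<ge> 1 \<Longrightarrow> E (X n) = 0"
    and "\<And>n. n \<ge> 1 \<Longrightarrow> conj_expectation E (X n) = 0"
    and "\<And>n \<omega>. S n \<omega> = (\<Sum>i=1..n. X i \<omega>)"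
    and "\<And>n. n \<ge> 1 \<Longrightarrow> 1 \<le> a n"
    and "mono_on {1..} a"
    and "filterlim a at_top sequentially"
    and "summable (\<lambda>n. E (\<lambda>\<omega>. (X (Suc n) \<omega>)\<^sup>2) / (a (Suc n))\<^sup>2)"
  shows "outer_capacity M H E
           {\<omega> \<in> space M. limsup (\<lambda>n. ereal (S n \<omega> / a n)) > 0 \<or>
                          liminf (\<lambda>n. ereal (S n \<omega> / a n)) < 0} = 0"
proof -
  interpret sublinear_expectation_space M H E by fact
  note XH = assms(2) and a_ge_1 = assms(7)
  have EX: "E (\<lambda>\<omega>. - X n \<omega>) = 0" if "n \<ge> 1" for n
    using assms(5)[OF that] by (simp add: conj_expectation_def)
  have S: "S n \<omega> = (\<Sum>i<n. X (Suc i) \<omega>)" for n \<omega>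
    by (induction n) (simp_all add: assms(6))
  define v where "v i = E (\<lambda>\<omega>. (X (Suc i) \<omega>)\<^sup>2)" for i
  have v: "0 \<le> v i" for i
    unfolding v_def by (intro E_nonneg H_square XH) auto
  define I where "I k = {i. a (Suc i) < 2 ^ Suc k}" for k
  have I: "\<exists>N. I k = {..<N}" for k
  proof -
    have ex: "\<exists>n. \<not> a (Suc n) < 2 ^ Suc k"
      using assms(9)[unfolded filterlim_at_top] unfolding eventually_sequentially
      by (meson le_SucI le_refl not_less)
    define N where "N = (LEAST n. \<not> a (Suc n) < 2 ^ Suc k)"
    have "\<not> a (Suc N) < 2 ^ Suc k" unfolding N_def using ex by (rule LeastI_ex)
    then have "\<not> a (Suc i) < 2 ^ Suc k" if "N \<le> i" for i
      using mono_onD[OF assms(8), of "Suc N" "Suc i"] that by auto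
    moreover have "a (Suc i) < 2 ^ Suc k" if "i < N" for i
      using not_less_Least[OF that[unfolded N_def]] by simp
    ultimately have "a (Suc i) < 2 ^ Suc k \<longleftrightarrow> i < N" for i
      by (metis not_less)
    then have "I k = {..<N}" by (simp add: I_def lessThan_def)
    then show ?thesis by blast
  qed
  then have finI: "finite (I k)" for k by (metis finite_lessThan)
  define w where "w k = (1/4) ^ k * (\<Sum>i\<in>I k. v i)" for k
  have w_nonneg: "0 \<le> w k" for k
    by (simp add: w_def sum_nonneg v)
  have "summable w"
  proof (rule summableI_nonneg_bounded[OF w_nonneg])
    fix K
    \<comment> \<open>As \<open>I k\<close> is contained in \<open>I K\<close> for
      \<open>k < K\<close>, an indicator lets all inner sums range over \<open>I K\<close>, and the
      order of summation can be exchanged.\<close>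
    have "(\<Sum>k<K. w k) = (\<Sum>k<K. \<Sum>i\<in>I K. v i * (if a (Suc i) < 2 ^ Suc k then (1/4) ^ k else 0))"
    proof (rule sum.cong[OF refl])
      fix k assume "k \<in> {..<K}"
      then have "(2 :: real) ^ Suc k \<le> 2 ^ Suc K" by (intro power_increasing) auto
      then have "I k = {i \<in> I K. a (Suc i) < 2 ^ Suc k}"
        by (auto simp: I_def simp del: power_Suc intro: less_le_trans)
      then show "w k = (\<Sum>i\<in>I K. v i * (if a (Suc i) < 2 ^ Suc k then (1/4) ^ k else 0))"
        unfolding w_def sum_distrib_left
        by (simp only: sum.inter_filter[OF finI]) (auto intro: sum.cong)
    qed
    also have "\<dots> = (\<Sum>i\<in>I K. v i * (\<Sum>k<K. if a (Suc i) < 2 ^ Suc k then (1/4) ^ k else 0))"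
      by (subst sum.swap) (simp add: sum_distrib_left)
    also have "\<dots> \<le> (\<Sum>i\<in>I K. v i * ((16/3) / (a (Suc i))\<^sup>2))"
    proof (intro sum_mono mult_left_mono sum_quarter_power_le v)
      show "0 < a (Suc i)" for i using a_ge_1[of "Suc i"] by simp
    qed
    also have "\<dots> = (16/3) * (\<Sum>i\<in>I K. v i / (a (Suc i))\<^sup>2)"
      by (simp add: sum_distrib_left mult_ac)
    also have "\<dots> \<le> (16/3) * (\<Sum>i. v i / (a (Suc i))\<^sup>2)"
      using assms(10) v by (intro mult_left_mono sum_le_suminf finI) (auto simp: v_def)
    finally show "(\<Sum>k<K. w k) \<le> (16/3) * (\<Sum>i. v i / (a (Suc i))\<^sup>2)" .
  qed
  \<comment> \<open>The threshold is the lower end \<open>2 ^ k\<close> of the dyadic range, scaled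
    by the precision \<open>1 / (j + 1)\<close>. Taking it as \<open>t\<close> in the maximal
    inequality gives the bound \<open>C j * w k\<close>.\<close>
  define B where "B j k = {\<omega> \<in> space M. \<exists>i\<in>I k. 2 ^ k / real (Suc j) < \<bar>S (Suc i) \<omega>\<bar>}" for j k
  define C where "C j = 8 * real (m + 1) ^ 3 * (real (Suc j))\<^sup>2" for j
  show ?thesis
  proof (rule outer_capacity_zeroI)
    fix j k
    have "(\<lambda>\<omega>. \<Sum>i<n. X (Suc i) \<omega>) \<in> borel_measurable M" for n
      using XH H_measurable by (intro borel_measurable_sum) auto
    then have [measurable]: "S n \<in> borel_measurable M" for n
      by (simp add: S[abs_def])
    have "countable (I k)" using finI by (rule countable_finite)
    then show "B j k \<in> sets M"
      unfolding B_def by measurable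
    obtain N where N: "I k = {..<N}" using I by blast
    have "capacity M H E (B j k)
      \<le> 8 * real (m + 1) ^ 3 / (2 ^ k / real (Suc j))\<^sup>2 * (\<Sum>i<N. E (\<lambda>\<omega>. (X (Suc i) \<omega>)\<^sup>2))"
    proof (rule maximal_inequality[OF XH assms(3,4) EX])
      fix \<omega> assume "\<omega> \<in> B j k"
      then obtain i where "i < N" "2 ^ k / real (Suc j) < \<bar>S (Suc i) \<omega>\<bar>"
        unfolding B_def N by blast
      then show "\<exists>n\<le>N. 2 ^ k / real (Suc j) < \<bar>\<Sum>i<n. X (Suc i) \<omega>\<bar>"
        using S by (intro exI[of _ "Suc i"]) auto
    qed auto
    also have "\<dots> = C j * w k"
    proof -
      have "((2 :: real) ^ k)\<^sup>2 = 4 ^ k" by (simp add: power2_eq_square flip: power_mult_distrib)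
      then show ?thesis by (simp add: C_def w_def N v_def power_divide)
    qed
    finally show "capacity M H E (B j k) \<le> C j * w k" .
    show "summable (\<lambda>k. C j * w k)" by (intro summable_mult) fact
    show "0 \<le> C j * w k" by (simp add: C_def w_nonneg)
  next
    fix \<omega> and K :: "nat \<Rightarrow> nat"
    assume \<omega>: "\<omega> \<in> {\<omega> \<in> space M. limsup (\<lambda>n. ereal (S n \<omega> / a n)) > 0 \<or>
                          liminf (\<lambda>n. ereal (S n \<omega> / a n)) < 0}"
    show "\<exists>j. \<exists>k\<ge>K j. \<omega> \<in> B j k"
    proof (rule ccontr)
      assume "\<not> ?thesis"
      then have notin: "\<omega> \<notin> B j k" if "K j \<le> k" for j k using that by blast
      have small: "\<forall>\<^sub>F n in sequentially. \<bar>S n \<omega> / a n\<bar> \<le> 1 / real (Suc j)" for j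
        using filterlim_at_top[THEN iffD1, OF assms(9), rule_format, of "2 ^ K j"] eventually_ge_at_top[of 1]
      proof eventually_elim
        case (elim n)
        \<comment> \<open>The dyadic level of \<open>a n\<close>: \<open>a n < 2 ^ Suc k\<close>
          puts the shifted index \<open>n - 1\<close> into \<open>I k\<close>,
          \<open>2 ^ k \<le> a n\<close> bounds the threshold by \<open>a n / (j + 1)\<close>, and
          \<open>a n \<ge> 2 ^ K j\<close> forces \<open>k \<ge> K j\<close>.\<close>
        define k where "k = nat \<lfloor>log 2 (a n)\<rfloor>"
        have pos: "1 \<le> a n" using a_ge_1 elim by blast
        then have "real k = of_int \<lfloor>log 2 (a n)\<rfloor>"
          by (simp add: k_def)
        then have "real k \<le> log 2 (a n)" "log 2 (a n) < real (Suc k)"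
          by linarith+
        then have lower: "2 ^ k \<le> a n" and upper: "a n < 2 ^ Suc k"
          using pos le_log_iff[of 2 "a n" "real k"] log_less_iff[of 2 "a n" "real (Suc k)"]
          by (simp_all add: powr_realpow[symmetric] del: power_Suc)
        have "(2 :: real) ^ K j < 2 ^ Suc k" using elim upper by simp
        then have "K j \<le> k" using power_less_imp_less_exp[of "2 :: real" "K j" "Suc k"] by simp
        moreover have "n - 1 \<in> I k" "Suc (n - 1) = n" using upper elim by (simp_all add: I_def)
        ultimately have "\<bar>S n \<omega>\<bar> \<le> 2 ^ k / real (Suc j)"
          using notin[of j k] \<omega> unfolding B_def by (force simp: not_less)
        also have "\<dots> \<le> a n / real (Suc j)"
          using lower by (rule divide_right_mono) simp
        finally show ?case using pos by (simp add: field_simps)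
      qed
      have "(\<lambda>n. S n \<omega> / a n) \<longlonglongrightarrow> 0"
      proof (rule tendstoI)
        fix e :: real assume "0 < e"
        then obtain j where "1 / real (Suc j) < e"
          using nat_approx_posE by blast
        then show "\<forall>\<^sub>F n in sequentially. dist (S n \<omega> / a n) 0 < e"
          using small[of j] by (auto elim!: eventually_mono)
      qed
      then have lim: "(\<lambda>n. ereal (S n \<omega> / a n)) \<longlonglongrightarrow> ereal 0"
        by (rule tendsto_ereal)
      show False
        using \<omega> lim_imp_Limsup[OF _ lim] lim_imp_Liminf[OF _ lim] by simp
    qed
  qed
qed

end
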